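(* Let $0<\theta<1$, let $\phi_1,\dots,\phi_N$ be finite Blaschke products with $\phi_i(0)=0$ for all $1\le i\le N$, and let $\tau$ be the action of $\mathbb{F}_N^+$ on $\mathbb{S}^1$ they generate. If $0\neq|\phi_j'(0)|<1$ for some $1\le j\le N$, then there exist constants $\kappa_0>0$, $C_0>0$, nonzero functions $f,g\in\mathcal{H}^0_\theta$, and a sequence $a_n\in\mathbb{F}_N^+$, $n\in\mathbb{N}$, with word length $|a_n|=n\to\infty$ such that $$\left|\int_{\mathbb{S}^1}\left(f\circ\tau(a_n)\right)\overline{g}\,d\mu\right|=C_0e^{-\kappa_0|a_n|}\|f\|_\theta\|g\|_\theta .$$
   Context: $\mathbb{S}^1=\{|z|=1\}$, $d\mu(z)=\frac{1}{2\pi i}\frac{dz}{z}$ is normalized Lebesgue measure on $\mathbb{S}^1$. A finite Blaschke product is a map $\phi(z)=e^{i\psi}\prod_{i=1}^q\frac{z-\lambda_i}{1-\overline{\lambda_i}z}$ with $\psi\in[0,2\pi)$, $|\lambda_i|<1$, $q\ge1$. $\mathbb{F}_N^+$ is the free semigroup of words $a=i_1\dots i_n$ in the letters $1,\dots,N$, with length $|a|=n$, acting by $\tau(a)z=\phi_{i_n}\circ\dots\circ\phi_{i_1}(z)$. For $0<\theta<1$, $\mathcal{H}_\theta$ is the closure of the linear combinations of $z^k$, $k\in\mathbb{Z}$, with respect to $\|f\|_\theta=\sqrt{\sum_{k\in\mathbb{Z}}|f_k|^2\theta^{-2|k|}}$, where $f_k$ are the Fourier coefficients of $f$; $\mathcal{H}^0_\theta$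 is the subspace of those $f$ with $f_0=0$. *)

theory Defs
  imports "HOL-Complex_Analysis.Complex_Analysis"
begin

text \<open>
  With \<open>z = e\<^sup>2\<^sup>\<pi>\<^sup>i\<^sup>t\<close> one has \<open>dz / (2 \<pi> i z) = dt\<close> on \<open>0 \<le> t \<le> 1\<close>; see
  \<open>circle_measure_integral\<close> below. The space of the measure is the circle itself, so that
  measurability is never affected by the values of a function off the circle.
\<close>

definition circle_measure :: "complex measure" where
  "circle_measure =
     distr (restrict_space lborel {0..1::real}) (restrict_space borel (sphere 0 1))
       (\<lambda>t. cis (2 * pi * t))"

lemma circle_measure_integral:
  fixes f :: "complex \<Rightarrow> complex"
  assumes "continuous_on (sphere 0 1) f"
  shows "(LINT z|circle_measure. f z) =
           1 / (2 * pi * \<i>) * contour_integral (circlepath 0 1) (\<lambda>z. f z / z)"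
proof -
  have cm: "(\<lambda>t. cis (2 * pi * t)) \<in>
      restrict_space lborel {0..1::real} \<rightarrow>\<^sub>M restrict_space borel (sphere 0 1)"
    by (intro measurable_restrict_space2 measurable_restrict_space1)
      (auto intro!: borel_measurable_continuous_onI continuous_intros)
  have fm: "f \<in> borel_measurable (restrict_space borel (sphere 0 1))"
    by (rule borel_measurable_continuous_on_restrict) (use assms in simp)
  have cont: "continuous_on {0..1} (\<lambda>t. f (cis (2 * pi * t)))"
    by (rule continuous_on_compose2[OF assms]) (auto intro!: continuous_intros)
  have "(LINT z|circle_measure. f z) =
      (LINT t|restrict_space lborel {0..1}. f (cis (2 * pi * t)))"
    unfolding circle_measure_def by (rule integral_distr[OF cm fm])
  also have "\<dots> = (LINT t:{0..1}|lborel. f (cis (2 * pi * t)))"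
    by (simp add: integral_restrict_space set_lebesgue_integral_def)
  also have "\<dots> = integral {0..1} (\<lambda>t. f (cis (2 * pi * t)))"
    by (rule set_borel_integral_eq_integral(2)[OF borel_integrable_atLeastAtMost'[OF cont]])
  also have "\<dots> = 1 / (2 * pi * \<i>) *
      integral {0..1} (\<lambda>t. f (circlepath 0 1 t) / circlepath 0 1 t *
        vector_derivative (circlepath 0 1) (at t))"
  proof -
    have "f (circlepath 0 1 t) / circlepath 0 1 t *
        vector_derivative (circlepath 0 1) (at t) =
        (2 * pi * \<i>) * f (cis (2 * pi * t))" for t
      by (simp add: vector_derivative_circlepath, simp add: circlepath cis_conv_exp mult_ac)
    then have "integral {0..1} (\<lambda>t. f (circlepath 0 1 t) / circlepath 0 1 t *
        vector_derivative (circlepath 0 1) (at t)) =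
        integral {0..1} (\<lambda>t. (2 * pi * \<i>) * f (cis (2 * pi * t)))"
      by (intro integral_cong) auto
    then show ?thesis by simp
  qed
  finally show ?thesis by (simp add: contour_integral_integral)
qed

text \<open>
  The formula is only required on the closed unit disc, which avoids the poles (where HOL's
  division would return 0) but determines both the derivative at 0 and all iterates on the circle.
\<close>

definition finite_blaschke :: "(complex \<Rightarrow> complex) \<Rightarrow> bool" where
  "finite_blaschke \<phi> \<longleftrightarrow>
     (\<exists>\<psi> q (l :: nat \<Rightarrow> complex). 0 \<le> \<psi> \<and> \<psi> < 2 * pi \<and> 1 \<le> (q::nat) \<and>
        (\<forall>i\<in>{1..q}. cmod (l i) < 1) \<and>
        (\<forall>z\<in>cball 0 1. \<phi> z = cis \<psi> * (\<Prod>i=1..q. (z - l i) / (1 - cnj (l i) * z))))"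

definition free_semigroup :: "nat \<Rightarrow> nat list set" where
  "free_semigroup N = lists {1..N}"

text \<open>\<open>fold \<phi> [i\<^sub>1, \<dots>, i\<^sub>n] = \<phi> i\<^sub>n \<circ> \<dots> \<circ> \<phi> i\<^sub>1\<close>\<close>

definition word_action :: "(nat \<Rightarrow> complex \<Rightarrow> complex) \<Rightarrow> nat list \<Rightarrow> complex \<Rightarrow> complex" where
  "word_action \<phi> a = fold \<phi> a"

definition fourier_coeff :: "(complex \<Rightarrow> complex) \<Rightarrow> int \<Rightarrow> complex" where
  "fourier_coeff f k = (LINT z|circle_measure. f z * cnj (z powi k))"

text \<open>
  An infinite sum that diverges has the value 0 in HOL, so finiteness of the norm
  is a separate predicate.
\<close>

definition theta_norm_finite :: "real \<Rightarrow> (complex \<Rightarrow> complex) \<Rightarrow> bool" where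
  "theta_norm_finite \<theta> f \<longleftrightarrow>
     (\<lambda>k::int. (cmod (fourier_coeff f k))\<^sup>2 * \<theta> powi (- 2 * \<bar>k\<bar>)) summable_on UNIV"

definition theta_norm :: "real \<Rightarrow> (complex \<Rightarrow> complex) \<Rightarrow> real" where
  "theta_norm \<theta> f =
     sqrt (\<Sum>\<^sub>\<infinity>k::int. (cmod (fourier_coeff f k))\<^sup>2 * \<theta> powi (- 2 * \<bar>k\<bar>))"

definition trig_polys :: "(complex \<Rightarrow> complex) set" where
  "trig_polys = {p. \<exists>K c. finite K \<and> p = (\<lambda>z. \<Sum>k\<in>K. c k * z powi (k::int))}"

definition square_integrable_circle :: "(complex \<Rightarrow> complex) set" where
  "square_integrable_circle =
     {f \<in> borel_measurable circle_measure. integrable circle_measure (\<lambda>z. (cmod (f z))\<^sup>2)}"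

text \<open>
  The closure is taken inside \<open>L\<^sup>2\<close> of the circle. Elements are functions rather than classes
  modulo equality almost everywhere, so the zero vector is any function vanishing almost everywhere.
\<close>

definition H_theta :: "real \<Rightarrow> (complex \<Rightarrow> complex) set" where
  "H_theta \<theta> = {f \<in> square_integrable_circle.
     \<forall>\<epsilon>>0. \<exists>p\<in>trig_polys. theta_norm_finite \<theta> (\<lambda>z. f z - p z) \<and>
                        theta_norm \<theta> (\<lambda>z. f z - p z) < \<epsilon>}"

definition H_theta0 :: "real \<Rightarrow> (complex \<Rightarrow> complex) set" where
  "H_theta0 \<theta> = {f \<in> H_theta \<theta>. fourier_coeff f 0 = 0}"

end

theory Submission
  imports Defs
begin

text \<open>
  The decay is already realised by the coordinate function. Take \<open>f = g = z\<close> and let \<open>a\<^sub>n\<close> be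
  the word \<open>j \<dots> j\<close> of length \<open>n\<close>, so that \<open>\<tau>(a\<^sub>n)\<close> is the \<open>n\<close>-th iterate of \<open>\<phi>\<^sub>j\<close>. The correlation
  integral is then the Fourier coefficient of \<open>\<phi>\<^sub>j\<^sup>n\<close> at the frequency \<open>1\<close>. The iterate is
  holomorphic in the open disc and continuous up to the circle, so by Cauchy's formula this
  coefficient is its derivative at \<open>0\<close>; because \<open>0\<close> is a fixed point, the chain rule gives
  \<open>(\<phi>\<^sub>j\<^sup>n)'(0) = \<phi>\<^sub>j'(0)\<^sup>n\<close>, which is exactly exponential in \<open>n\<close>. Hence \<open>\<kappa>\<^sub>0 = - ln \<bar>\<phi>\<^sub>j'(0)\<bar>\<close>, positive
  since \<open>0 < \<bar>\<phi>\<^sub>j'(0)\<bar> < 1\<close>. The only nonzero Fourier coefficient of \<open>z\<close> is a \<open>1\<close> at the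
  frequency \<open>1\<close>, so \<open>\<parallel>z\<parallel>\<^sub>\<theta> = 1 / \<theta>\<close>, and \<open>C\<^sub>0 = \<theta>\<^sup>2\<close> cancels the two norms.

  The proof rests on three facts: \<open>fourier_coeff_disc_algebra\<close> and
  \<open>fourier_coeff_disc_algebra_negative\<close> (Fourier coefficients as Taylor coefficients),
  \<open>finite_blaschke_self_map\<close> (the closed disc is invariant, so iteration stays within the scope of
  Cauchy's formula), and \<open>deriv_funpow_fixpoint\<close>.
\<close>

section \<open>Fourier coefficients of functions holomorphic in the disc\<close>

lemma cnj_power_unit_circle:
  fixes z :: complex
  assumes "cmod z = 1"
  shows "cnj (z ^ k) = 1 / z ^ k"
proof -
  have "z ^ k * cnj (z ^ k) = 1"
    unfolding complex_norm_square[symmetric] by (simp add: norm_power assms)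
  moreover have "z ^ k \<noteq> 0"
    using assms by auto
  ultimately show ?thesis by (simp add: field_simps)
qed

text \<open>
  On the circle \<open>cnj (z ^ k) = 1 / z ^ k\<close>, which turns the integrand into the Cauchy kernel at \<open>0\<close>.
\<close>

lemma fourier_coeff_disc_algebra:
  assumes cont: "continuous_on (cball 0 1) F" and hol: "F holomorphic_on ball 0 1"
  shows "fourier_coeff F (int k) = (deriv ^^ k) F 0 / fact k"
proof -
  have sph: "continuous_on (sphere 0 1) F"
    by (rule continuous_on_subset[OF cont]) auto
  have "fourier_coeff F (int k) =
      1 / (2 * pi * \<i>) * contour_integral (circlepath 0 1) (\<lambda>z. F z * cnj (z ^ k) / z)"
    unfolding fourier_coeff_def power_int_of_nat
    by (rule circle_measure_integral) (intro continuous_intros sph)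
  also have "contour_integral (circlepath 0 1) (\<lambda>z. F z * cnj (z ^ k) / z) =
      contour_integral (circlepath 0 1) (\<lambda>z. F z / (z - 0) ^ Suc k)"
    by (rule contour_integral_eq) (auto simp: cnj_power_unit_circle simp del: complex_cnj_power)
  also have "\<dots> = 2 * pi * \<i> * (deriv ^^ k) F 0 / fact k"
    by (rule Cauchy_contour_integral_circlepath[OF cont hol]) simp
  finally show ?thesis by simp
qed

text \<open>
  Conjugation turns a negative power into a positive one, so the coefficient is the mean over the
  circle of a function that is holomorphic in the disc and vanishes at \<open>0\<close>.
\<close>

lemma fourier_coeff_disc_algebra_negative:
  assumes cont: "continuous_on (cball 0 1) F" and hol: "F holomorphic_on ball 0 1"
    and "k < 0"
  shows "fourier_coeff F k = 0"
proof -
  obtain m where k: "k = - int (Suc m)"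
    using \<open>k < 0\<close> by (metis negD)
  let ?G = "\<lambda>z. F z * z ^ Suc m"
  have "fourier_coeff F k = fourier_coeff ?G 0"
    unfolding fourier_coeff_def
  proof (rule Bochner_Integration.integral_cong[OF refl])
    fix z assume "z \<in> space circle_measure"
    then have z: "cmod z = 1"
      by (simp add: circle_measure_def space_restrict_space)
    have "cnj (z powi k) = cnj (1 / z ^ Suc m)"
      unfolding k power_int_minus power_int_of_nat by (simp only: inverse_eq_divide)
    also have "\<dots> = z ^ Suc m"
      unfolding cnj_power_unit_circle[OF z, symmetric] by simp
    finally show "F z * cnj (z powi k) = F z * z ^ Suc m * cnj (z powi 0)"
      by simp
  qed
  also have "\<dots> = ?G 0"
    using fourier_coeff_disc_algebra[of ?G 0] cont hol
    by (simp add: continuous_intros holomorphic_intros)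
  finally show ?thesis by simp
qed

section \<open>The coordinate function as a vector of the space\<close>

lemma fourier_coeff_coordinate: "fourier_coeff (\<lambda>z. z) k = (if k = 1 then 1 else 0)"
proof (cases "k < 0")
  case True
  then show ?thesis
    by (simp add: fourier_coeff_disc_algebra_negative)
next
  case False
  then obtain m where k: "k = int m"
    using zero_le_imp_eq_int by (metis not_less)
  show ?thesis
    unfolding k by (simp add: fourier_coeff_disc_algebra)
qed

lemma theta_norm_coordinate:
  assumes "0 < \<theta>"
  shows "theta_norm \<theta> (\<lambda>z. z) = 1 / \<theta>"
proof -
  have "(\<Sum>\<^sub>\<infinity>k. (cmod (fourier_coeff (\<lambda>z. z) k))\<^sup>2 * \<theta> powi (- 2 * \<bar>k\<bar>)) =
      (\<Sum>\<^sub>\<infinity>k\<in>{1}. \<theta> powi (- 2 * \<bar>k\<bar>))"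
    by (rule infsum_cong_neutral) (auto simp: fourier_coeff_coordinate)
  also have "\<dots> = (1 / \<theta>)\<^sup>2"
    by (simp add: power_int_minus power_divide inverse_eq_divide)
  finally show ?thesis
    using assms by (simp add: theta_norm_def del: power_one_over)
qed

lemma emeasure_circle_measure: "emeasure circle_measure (space circle_measure) = 1"
proof -
  have "(\<lambda>t. cis (2 * pi * t)) \<in>
      restrict_space lborel {0..1::real} \<rightarrow>\<^sub>M restrict_space borel (sphere 0 1)"
    by (intro measurable_restrict_space2 measurable_restrict_space1)
      (auto intro!: borel_measurable_continuous_onI continuous_intros)
  then have "emeasure circle_measure (space circle_measure) =
      emeasure (restrict_space lborel {0..1::real}) (space (restrict_space lborel {0..1::real}))"
    unfolding circle_measure_def
    by (subst emeasure_distr)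
       (auto simp: sets_restrict_space_iff dest: measurable_space intro!: arg_cong2[where f = emeasure])
  then show ?thesis
    by (simp add: emeasure_restrict_space space_restrict_space)
qed

text \<open>
  A trigonometric polynomial approximates itself with error \<open>0\<close>, and \<open>\<bar>z\<bar> = 1\<close> is square integrable
  for a finite measure.
\<close>

lemma coordinate_in_H_theta0: "(\<lambda>z. z) \<in> H_theta0 \<theta>"
proof -
  interpret finite_measure circle_measure
    by (rule finite_measureI) (simp add: emeasure_circle_measure)
  have meas: "(\<lambda>z. z) \<in> borel_measurable circle_measure"
    unfolding circle_measure_def by (simp add: measurable_restrict_space1)
  have unit: "cmod z = 1" if "z \<in> space circle_measure" for z
    using that by (simp add: circle_measure_def space_restrict_space)
  have "integrable circle_measure (\<lambda>z. (cmod z)\<^sup>2)"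
    by (subst Bochner_Integration.integrable_cong[OF refl, where g = "\<lambda>_. 1"]) (auto simp: unit)
  then have "(\<lambda>z. z) \<in> square_integrable_circle"
    using meas by (simp add: square_integrable_circle_def)
  moreover have "(\<lambda>z. z) \<in> trig_polys"
    unfolding trig_polys_def
    by (intro CollectI exI[of _ "{1}"] exI[of _ "\<lambda>_. 1"]) auto
  moreover have "theta_norm_finite \<theta> (\<lambda>z. z - z)" "theta_norm \<theta> (\<lambda>z. z - z) = 0"
    by (simp_all add: theta_norm_finite_def theta_norm_def fourier_coeff_def)
  ultimately have "(\<lambda>z. z) \<in> H_theta \<theta>"
    unfolding H_theta_def by force
  then show ?thesis
    by (simp add: H_theta0_def fourier_coeff_coordinate)
qed

lemma coordinate_not_AE_zero: "\<not> (AE z in circle_measure. z = 0)"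
proof
  assume "AE z in circle_measure. z = 0"
  moreover have "AE z in circle_measure. z \<noteq> 0"
    by (rule AE_I2) (auto simp: circle_measure_def space_restrict_space)
  ultimately have "AE z in circle_measure. False"
    by eventually_elim simp
  then have "emeasure circle_measure (space circle_measure) = 0"
    by (simp add: ae_filter_eq_bot_iff[symmetric] trivial_limit_def)
  then show False
    by (simp add: emeasure_circle_measure)
qed

section \<open>Finite Blaschke products and their iterates\<close>

lemma blaschke_denominator_nonzero:
  fixes l z :: complex
  assumes "cmod l < 1" "cmod z \<le> 1"
  shows "1 - cnj l * z \<noteq> 0"
proof
  assume "1 - cnj l * z = 0"
  then have "cmod (cnj l * z) = 1" by simp
  moreover have "cmod (cnj l * z) \<le> cmod l * 1"
    unfolding norm_mult complex_mod_cnj using assms by (intro mult_left_mono) auto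
  ultimately show False using assms by simp
qed

lemma finite_blaschke_continuous_on:
  assumes "finite_blaschke F"
  shows "continuous_on (cball 0 1) F"
proof -
  obtain \<psi> q l where l: "\<forall>i\<in>{1..q::nat}. cmod (l i) < 1"
    and F: "\<forall>z\<in>cball 0 1. F z = cis \<psi> * (\<Prod>i=1..q. (z - l i) / (1 - cnj (l i) * z))"
    using assms unfolding finite_blaschke_def by blast
  have "continuous_on (cball 0 1) (\<lambda>z. cis \<psi> * (\<Prod>i=1..q. (z - l i) / (1 - cnj (l i) * z)))"
    using l by (intro continuous_intros ballI blaschke_denominator_nonzero) auto
  then show ?thesis
    by (rule continuous_on_eq) (use F in auto)
qed

lemma finite_blaschke_holomorphic_on:
  assumes "finite_blaschke F"
  shows "F holomorphic_on ball 0 1"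
proof -
  obtain \<psi> q l where l: "\<forall>i\<in>{1..q::nat}. cmod (l i) < 1"
    and F: "\<forall>z\<in>cball 0 1. F z = cis \<psi> * (\<Prod>i=1..q. (z - l i) / (1 - cnj (l i) * z))"
    using assms unfolding finite_blaschke_def by blast
  have "(\<lambda>z. cis \<psi> * (\<Prod>i=1..q. (z - l i) / (1 - cnj (l i) * z))) holomorphic_on ball 0 1"
    using l by (intro holomorphic_intros blaschke_denominator_nonzero) auto
  then show ?thesis
    by (rule holomorphic_transform) (use F in auto)
qed

text \<open>
  Each factor is a disc automorphism, so a nonempty product of them has modulus less than \<open>1\<close> inside
  the disc. By continuity the bound passes to the closed disc.
\<close>

lemma finite_blaschke_self_map:
  assumes "finite_blaschke F"
  shows "F ` ball 0 1 \<subseteq> ball 0 1" and "F ` cball 0 1 \<subseteq> cball 0 1"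
proof -
  obtain \<psi> q l where q: "1 \<le> (q::nat)" and l: "\<forall>i\<in>{1..q}. cmod (l i) < 1"
    and F: "\<forall>z\<in>cball 0 1. F z = cis \<psi> * (\<Prod>i=1..q. (z - l i) / (1 - cnj (l i) * z))"
    using assms unfolding finite_blaschke_def by blast
  show ball: "F ` ball 0 1 \<subseteq> ball 0 1"
  proof (intro image_subsetI)
    fix z :: complex assume z: "z \<in> ball 0 1"
    have "cmod (F z) = (\<Prod>i=1..q. cmod (Moebius_function 0 (l i) z))"
      using F z by (simp add: norm_mult prod_norm Moebius_function_simple)
    also have "\<dots> < (\<Prod>i=1..q. 1)"
      using z l q
      by (intro prod_mono_strict[where i = 1])
         (auto simp: Moebius_function_norm_lt_1 intro: less_imp_le)
    finally show "F z \<in> ball 0 1" by simp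
  qed
  have "F ` closure (ball 0 1) \<subseteq> cball 0 1"
    using ball finite_blaschke_continuous_on[OF assms]
    by (intro image_closure_subset) auto
  then show "F ` cball 0 1 \<subseteq> cball 0 1" by simp
qed

lemma continuous_on_funpow:
  assumes "continuous_on S F" "F ` S \<subseteq> S"
  shows "continuous_on S (F ^^ n)"
proof (induction n)
  case (Suc n)
  have "(F ^^ n) ` S \<subseteq> S"
    using assms(2) by (induction n) auto
  with Suc show ?case
    unfolding funpow.simps by (intro continuous_on_compose continuous_on_subset[OF assms(1)])
qed (simp add: id_def)

lemma holomorphic_on_funpow:
  assumes "F holomorphic_on S" "F ` S \<subseteq> S"
  shows "(F ^^ n) holomorphic_on S"
proof (induction n)
  case (Suc n)
  have "(F ^^ n) ` S \<subseteq> S"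
    using assms(2) by (induction n) auto
  with Suc show ?case
    unfolding funpow.simps by (intro holomorphic_on_compose holomorphic_on_subset[OF assms(1)])
qed (simp add: id_def)

text \<open>
  At a fixed point every factor in the chain rule is evaluated at the same point.
\<close>

lemma deriv_funpow_fixpoint:
  fixes F :: "'a::real_normed_field \<Rightarrow> 'a"
  assumes "F field_differentiable at x" "F x = x"
  shows "deriv (F ^^ n) x = deriv F x ^ n"
proof -
  have fix_iter: "(F ^^ n) x = x" for n
    using assms(2) by (induction n) auto
  have "((F ^^ n) has_field_derivative deriv F x ^ n) (at x)"
  proof (induction n)
    case (Suc n)
    have "(F has_field_derivative deriv F x) (at ((F ^^ n) x))"
      using assms(1) by (simp add: fix_iter field_differentiable_derivI)
    from DERIV_chain[OF this Suc] show ?case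
      by (simp only: funpow.simps power_Suc)
  qed (simp add: id_def)
  then show ?thesis by (rule DERIV_imp_deriv)
qed

lemma word_action_replicate: "word_action \<phi> (replicate n j) = \<phi> j ^^ n"
  unfolding word_action_def
  by (induction n) (simp_all add: funpow_swap1 fun_eq_iff id_def)

lemma blaschke_iterate_correlation:
  assumes "finite_blaschke F" "F 0 = 0"
  shows "(LINT z|circle_measure. (F ^^ n) z * cnj z) = deriv F 0 ^ n"
proof -
  have cont: "continuous_on (cball 0 1) (F ^^ n)"
    using assms finite_blaschke_continuous_on finite_blaschke_self_map(2)
    by (intro continuous_on_funpow) auto
  have hol: "(F ^^ n) holomorphic_on ball 0 1"
    using assms finite_blaschke_holomorphic_on finite_blaschke_self_map(1)
    by (intro holomorphic_on_funpow) auto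
  have "(LINT z|circle_measure. (F ^^ n) z * cnj z) = fourier_coeff (F ^^ n) (int 1)"
    by (simp add: fourier_coeff_def)
  also have "\<dots> = deriv (F ^^ n) 0"
    unfolding fourier_coeff_disc_algebra[OF cont hol] by simp
  also have "\<dots> = deriv F 0 ^ n"
    using finite_blaschke_holomorphic_on[OF assms(1)] assms(2)
    by (intro deriv_funpow_fixpoint)
       (auto intro: holomorphic_on_imp_differentiable_at[OF _ open_ball])
  finally show ?thesis .
qed

section \<open>An exactly exponential sequence of correlations\<close>

theorem lemma3p2:
  fixes \<theta> :: real and N :: nat and \<phi> :: "nat \<Rightarrow> complex \<Rightarrow> complex"
  assumes "0 < \<theta>" and "\<theta> < 1"
    and "\<And>i. i \<in> {1..N} \<Longrightarrow> finite_blaschke (\<phi> i)"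
    and "\<And>i. i \<in> {1..N} \<Longrightarrow> \<phi> i 0 = 0"
    and "\<exists>j\<in>{1..N}. 0 \<noteq> cmod (deriv (\<phi> j) 0) \<and> cmod (deriv (\<phi> j) 0) < 1"
  shows "\<exists>(\<kappa>\<^sub>0::real) (C\<^sub>0::real) f g (a :: nat \<Rightarrow> nat list).
           \<kappa>\<^sub>0 > 0 \<and> C\<^sub>0 > 0 \<and>
           f \<in> H_theta0 \<theta> \<and> \<not> (AE z in circle_measure. f z = 0) \<and>
           g \<in> H_theta0 \<theta> \<and> \<not> (AE z in circle_measure. g z = 0) \<and>
           (\<forall>n. a n \<in> free_semigroup N \<and> length (a n) = n \<and>
              cmod (LINT z|circle_measure. f (word_action \<phi> (a n) z) * cnj (g z)) =
                C\<^sub>0 * exp (- \<kappa>\<^sub>0 * real (length (a n))) * theta_norm \<theta> f * theta_norm \<theta> g)"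
proof -
  obtain j where j: "j \<in> {1..N}" and nz: "0 \<noteq> cmod (deriv (\<phi> j) 0)"
    and lt: "cmod (deriv (\<phi> j) 0) < 1"
    using assms(5) by blast
  define d where "d = cmod (deriv (\<phi> j) 0)"
  have d: "0 < d" "d < 1"
    using nz lt by (auto simp: d_def)
  have decay: "cmod (LINT z|circle_measure. word_action \<phi> (replicate n j) z * cnj z) =
      \<theta>\<^sup>2 * exp (- (- ln d) * real n) * theta_norm \<theta> (\<lambda>z. z) * theta_norm \<theta> (\<lambda>z. z)" for n
  proof -
    have "cmod (LINT z|circle_measure. word_action \<phi> (replicate n j) z * cnj z) = d ^ n"
      by (simp add: word_action_replicate blaschke_iterate_correlation[OF assms(3,4)[OF j]]
          norm_power d_def)
    also have "\<dots> = exp (- (- ln d) * real n)"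
      using d by (simp add: exp_of_nat2_mult)
    finally show ?thesis
      using assms(1) by (simp add: theta_norm_coordinate power2_eq_square)
  qed
  show ?thesis
  proof (intro exI conjI allI)
    show "0 < - ln d" using d by simp
    show "0 < \<theta>\<^sup>2" using assms(1) by simp
    show "replicate n j \<in> free_semigroup N" for n
      using j by (auto simp: free_semigroup_def)
    show "length (replicate n j) = n" for n
      by simp
    show "cmod (LINT z|circle_measure. word_action \<phi> (replicate n j) z * cnj z) =
        \<theta>\<^sup>2 * exp (- (- ln d) * real (length (replicate n j))) *
          theta_norm \<theta> (\<lambda>z. z) * theta_norm \<theta> (\<lambda>z. z)" for n
      using decay by simp
  qed (rule coordinate_in_H_theta0 coordinate_not_AE_zero)+
qed

end
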